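(* Let $n,m$ be positive integers such that $1<m<n$. Let $k=n-m$. Then $\kappa_U(G)\geq\min\{\delta_U(G),k\}$ for any $k$-critical-bipartite graph $G=(U,V;E)$ with $|U|=n$ and $|V|=m$. Moreover, for every separator $Z$ in $G$ with $|Z|<k$, there exists a vertex $u\in U$ with $N(u)\subseteq Z$.
   Context: All graphs are finite, simple and undirected. $G=(U,V;E)$ denotes a bipartite graph with color classes $U,V$ and edge set $E$. A bipartite graph $G=(U,V;E)$ with $k=|U|-|V|\ge 0$ is $k$-critical-bipartite if, after deleting any $k$ vertices from $U$, the remaining subgraph has a perfect matching. $\delta_U(G)$ denotes the minimum degree in $G$ of a vertex in $U$, and $N(u)$ is the set of neighbors of $u$ in $G$. A vertex cut separating two vertices $u,v$ of the same component of $G$ is a set $Z$ of vertices of $G$ whose removal leaves $u$ and $v$ (neither in $Z$) in different components of $G-Z$; a separator is a set of vertices that is a vertex cut separating some two vertices of $G$. For a set $S$ of vertices of $G$, the set connectivity $\kappa_S(G)$ is the size of a smallest vertex cut separating some two vertices $u,v\in S$. In particular $\kappa_U(G)$ is the set connectivity of the color class $U$. *)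

theory Defs
  imports "Graph_Theory.Digraph_Component"
begin

text \<open>
  Finite simple undirected graphs are the library's \<^locale>\<open>graph\<close>: finite symmetric digraphs
  without loops and parallel arcs.  An undirected edge \<open>{u, v}\<close> is thus a pair of opposite arcs.
\<close>

definition neighbors :: "('a, 'b) pre_digraph \<Rightarrow> 'a \<Rightarrow> 'a set" where
  "neighbors G u = {v. u \<rightarrow>\<^bsub>G\<^esub> v}"

definition edges :: "('a, 'b) pre_digraph \<Rightarrow> 'a set set" where
  "edges G = {{u, v} | u v. u \<rightarrow>\<^bsub>G\<^esub> v}"

definition delete_verts :: "('a, 'b) pre_digraph \<Rightarrow> 'a set \<Rightarrow> ('a, 'b) pre_digraph" where
  "delete_verts G Z = G \<restriction> (verts G - Z)"

definition bipartite_graph :: "('a, 'b) pre_digraph \<Rightarrow> 'a set \<Rightarrow> 'a set \<Rightarrow> bool" where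
  "bipartite_graph G U V \<longleftrightarrow> graph G \<and> verts G = U \<union> V \<and> U \<inter> V = {} \<and>
     (\<forall>x y. x \<rightarrow>\<^bsub>G\<^esub> y \<longrightarrow> (x \<in> U \<and> y \<in> V) \<or> (x \<in> V \<and> y \<in> U))"

definition perfect_matching :: "('a, 'b) pre_digraph \<Rightarrow> 'a set set \<Rightarrow> bool" where
  "perfect_matching G M \<longleftrightarrow> M \<subseteq> edges G \<and> pairwise disjnt M \<and> \<Union>M = verts G"

definition critical_bipartite :: "nat \<Rightarrow> ('a, 'b) pre_digraph \<Rightarrow> 'a set \<Rightarrow> 'a set \<Rightarrow> bool" where
  "critical_bipartite k G U V \<longleftrightarrow> bipartite_graph G U V \<and> card U = card V + k \<and>
     (\<forall>W. W \<subseteq> U \<and> card W = k \<longrightarrow> (\<exists>M. perfect_matching (delete_verts G W) M))"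

text \<open>
  In a \<^locale>\<open>graph\<close>, the out-degree is the number of undirected edges at a vertex.  The minimum
  is meaningful only for finite nonempty \<open>S\<close>.
\<close>

definition min_degree_on :: "('a, 'b) pre_digraph \<Rightarrow> 'a set \<Rightarrow> nat" where
  "min_degree_on G S = Min (out_degree G ` S)"

text \<open>
  Being in the same component of a \<^locale>\<open>graph\<close> is expressed by reachability, which holds only
  between vertices of the graph and is reflexive on them.
\<close>

definition vertex_cut :: "('a, 'b) pre_digraph \<Rightarrow> 'a set \<Rightarrow> 'a \<Rightarrow> 'a \<Rightarrow> bool" where
  "vertex_cut G Z u v \<longleftrightarrow> u \<rightarrow>\<^sup>*\<^bsub>G\<^esub> v \<and> Z \<subseteq> verts G \<and> u \<notin> Z \<and> v \<notin> Z \<and>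
     \<not> u \<rightarrow>\<^sup>*\<^bsub>delete_verts G Z\<^esub> v"

definition is_separator :: "('a, 'b) pre_digraph \<Rightarrow> 'a set \<Rightarrow> bool" where
  "is_separator G Z \<longleftrightarrow> (\<exists>u v. vertex_cut G Z u v)"

text \<open>
  If no two vertices of \<open>S\<close> can be separated, the infimum below is that of the empty set of natural
  numbers, i.e. \<open>0\<close>; hence a positive lower bound on the set connectivity is never vacuous.
\<close>

definition set_connectivity :: "('a, 'b) pre_digraph \<Rightarrow> 'a set \<Rightarrow> nat" where
  "set_connectivity G S = Inf {card Z | Z. \<exists>u\<in>S. \<exists>v\<in>S. vertex_cut G Z u v}"

end

theory Submission
  imports Defs
begin

text \<open>
  Deleting \<open>k\<close> vertices inside \<open>N(T)\<close> and matching the rest shows \<open>|N(T)| \<ge> |T| + k\<close> for every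
  nonempty \<open>T \<subseteq> V\<close>.  Let \<open>Z\<close> split the remaining vertices into parts \<open>A\<close> and \<open>B\<close> with no edge
  between them.  If both meet \<open>V\<close>, adding this inequality for \<open>A \<inter> V\<close> and \<open>B \<inter> V\<close> gives
  \<open>n + |Z \<inter> U| \<ge> m - |Z \<inter> V| + 2 k\<close>, that is \<open>|Z| \<ge> k\<close>.  Otherwise one part consists of vertices
  of \<open>U\<close>, all of whose neighbours lie in \<open>Z\<close>.
\<close>

lemma finite_verts_bipartite:
  assumes "bipartite_graph G U V"
  shows "finite U" "finite V"
proof -
  interpret graph G using assms by (simp add: bipartite_graph_def)
  have "verts G = U \<union> V" using assms by (simp add: bipartite_graph_def)
  with finite_verts have "finite (U \<union> V)" by simp
  then show "finite U" "finite V" by auto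
qed

lemma dominates_delete_verts_iff:
  assumes "wf_digraph G"
  shows "u \<rightarrow>\<^bsub>delete_verts G Z\<^esub> v \<longleftrightarrow> u \<rightarrow>\<^bsub>G\<^esub> v \<and> u \<notin> Z \<and> v \<notin> Z"
proof -
  interpret wf_digraph G by fact
  show ?thesis
    unfolding delete_verts_def arcs_ends_def arc_to_ends_def
    by (auto simp: induce_subgraph_arcs induce_subgraph_tail induce_subgraph_head image_iff)
qed

lemma verts_delete_verts [simp]: "verts (delete_verts G Z) = verts G - Z"
  by (simp add: delete_verts_def)

lemma reachable_delete_verts_imp_reachable:
  assumes "wf_digraph G" "u \<rightarrow>\<^sup>*\<^bsub>delete_verts G Z\<^esub> v"
  shows "u \<rightarrow>\<^sup>*\<^bsub>G\<^esub> v"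
proof -
  interpret wf_digraph G by fact
  have "subgraph (delete_verts G Z) G"
    unfolding delete_verts_def by (intro subgraph_induce_subgraphI) auto
  then show ?thesis using reachable_mono assms(2) by blast
qed

lemma neighbors_bipartite:
  assumes "bipartite_graph G U V"
  shows "u \<in> U \<Longrightarrow> neighbors G u \<subseteq> V" "v \<in> V \<Longrightarrow> neighbors G v \<subseteq> U"
  using assms unfolding bipartite_graph_def neighbors_def by blast+

text \<open>Links the degree, which counts arcs, to neighbour sets: without parallel arcs,
  \<open>head G\<close> is injective on the arcs leaving \<open>u\<close>.\<close>

lemma out_degree_le_card_neighbors:
  assumes "graph G"
  shows "out_degree G u \<le> card (neighbors G u)"
proof -
  interpret graph G by fact
  have "inj_on (head G) (out_arcs G u)"
    using no_multi_arcs by (auto simp: inj_on_def arc_to_ends_def)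
  moreover have "head G ` out_arcs G u \<subseteq> neighbors G u"
    by (auto simp: neighbors_def arcs_ends_def arc_to_ends_def)
  moreover have "finite (neighbors G u)"
    by (rule finite_subset[OF _ finite_verts]) (auto simp: neighbors_def adj_in_verts)
  ultimately show ?thesis
    unfolding out_degree_def by (metis card_inj_on_le)
qed

text \<open>The easy direction of Hall's condition. As \<open>W\<close> lies in \<open>U\<close>,
  every vertex of \<open>T\<close> survives the deletion, and its matching partner is a neighbour
  outside \<open>W\<close>; partners of distinct vertices differ.\<close>

lemma perfect_matching_expansion:
  assumes bip: "bipartite_graph G U V"
    and pm: "perfect_matching (delete_verts G W) M"
    and "W \<subseteq> U" "T \<subseteq> V"
  shows "card T \<le> card ((\<Union>t\<in>T. neighbors G t) - W)"
proof -
  interpret graph G using bip by (simp add: bipartite_graph_def)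
  have disj: "U \<inter> V = {}" and vG: "verts G = U \<union> V"
    using bip by (auto simp: bipartite_graph_def)
  have "\<exists>s. {t, s} \<in> M \<and> s \<in> neighbors G t - W" if "t \<in> T" for t
  proof -
    have "t \<in> \<Union>M" using pm that assms(3,4) disj vG by (auto simp: perfect_matching_def)
    then obtain e where e: "e \<in> M" "t \<in> e" by blast
    then obtain a b where ab: "e = {a, b}" "a \<rightarrow>\<^bsub>delete_verts G W\<^esub> b"
      using pm by (auto simp: perfect_matching_def edges_def)
    then have arc: "a \<rightarrow>\<^bsub>G\<^esub> b" "b \<rightarrow>\<^bsub>G\<^esub> a" "a \<notin> W" "b \<notin> W"
      using dominates_delete_verts_iff[OF wf_digraph_axioms] graph_symmetric by blast+
    have "t = a \<or> t = b" using e ab by auto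
    then show ?thesis
    proof
      assume "t = a"
      then show ?thesis using arc e ab by (auto simp: neighbors_def)
    next
      assume "t = b"
      then show ?thesis using arc e ab by (auto simp: neighbors_def insert_commute)
    qed
  qed
  then obtain s where s: "\<And>t. t \<in> T \<Longrightarrow> {t, s t} \<in> M \<and> s t \<in> neighbors G t - W"
    by metis
  \<comment> \<open>Partners lie in \<open>U\<close> and \<open>T\<close> in \<open>V\<close>, so
    equal matching edges \<open>{x, s x}\<close> and \<open>{y, s y}\<close> must have
    \<open>x = y\<close>; their ends cannot be swapped.\<close>
  have sU: "s t \<in> U" if "t \<in> T" for t
    using s[OF that] neighbors_bipartite(2)[OF bip] that \<open>T \<subseteq> V\<close> by blast
  have "inj_on s T"
  proof (rule inj_onI)
    fix x y assume xy: "x \<in> T" "y \<in> T" "s x = s y"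
    have "{x, s x} = {y, s y}"
    proof (rule ccontr)
      assume "{x, s x} \<noteq> {y, s y}"
      then have "disjnt {x, s x} {y, s y}"
        using s[OF xy(1)] s[OF xy(2)] pm pairwiseD unfolding perfect_matching_def by metis
      then show False using xy(3) by simp
    qed
    then show "x = y" using sU[OF xy(1)] sU[OF xy(2)] xy \<open>T \<subseteq> V\<close> disj by auto
  qed
  moreover have "s ` T \<subseteq> (\<Union>t\<in>T. neighbors G t) - W" using s by auto
  moreover have "finite ((\<Union>t\<in>T. neighbors G t) - W)"
    by (rule finite_subset[OF _ finite_verts]) (auto simp: neighbors_def adj_in_verts)
  ultimately show ?thesis by (metis card_inj_on_le)
qed

lemma critical_bipartite_expansion:
  assumes crit: "critical_bipartite k G U V" and "T \<subseteq> V" "T \<noteq> {}"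
  shows "card T + k \<le> card (\<Union>t\<in>T. neighbors G t)"
proof -
  let ?N = "\<Union>t\<in>T. neighbors G t"
  have bip: "bipartite_graph G U V" and cU: "card U = card V + k"
    using crit by (auto simp: critical_bipartite_def)
  note fin = finite_verts_bipartite[OF bip]
  have NU: "?N \<subseteq> U" using neighbors_bipartite(2)[OF bip] \<open>T \<subseteq> V\<close> by blast
  have finN: "finite ?N" using NU fin(1) finite_subset by blast
  have expand: "card T \<le> card (?N - W)" if "W \<subseteq> U" "card W = k" for W
  proof -
    from that crit obtain M where "perfect_matching (delete_verts G W) M"
      unfolding critical_bipartite_def by blast
    with perfect_matching_expansion[OF bip] that \<open>T \<subseteq> V\<close> show ?thesis by blast
  qed
  show ?thesis
  proof (cases "k \<le> card ?N")
    case True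
    \<comment> \<open>Deleting \<open>W\<close> from inside the neighbourhood makes the matching
      bound as strong as possible: all \<open>k\<close> lost vertices are neighbours of
      \<open>T\<close>.\<close>
    then obtain W where W: "W \<subseteq> ?N" "card W = k" using obtain_subset_with_card_n by metis
    then have "card (?N - W) = card ?N - k"
      using finN by (metis card_Diff_subset finite_subset)
    then show ?thesis using expand[of W] W NU True by force
  next
    case False
    \<comment> \<open>Such a \<open>W\<close> fits between the neighbourhood and \<open>U\<close>
      because \<open>k \<le> card U\<close>. Deleting it leaves \<open>T\<close> no possible
      partners, which contradicts \<open>T \<noteq> {}\<close>.\<close>
    then obtain W where W: "?N \<subseteq> W" "W \<subseteq> U" "card W = k"
      using exists_subset_between[of ?N k U] NU fin(1) cU by auto
    then have "card T \<le> card (?N - W)" using expand by blast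
    also have "?N - W = {}" using W by blast
    finally have "card T = 0" by simp
    then show ?thesis
      using \<open>T \<noteq> {}\<close> \<open>T \<subseteq> V\<close> fin(2) finite_subset by (metis card_0_eq)
  qed
qed

text \<open>Reachability of \<open>y\<close> from \<open>x\<close> in \<open>G\<close> itself is not
  assumed, so the lemma serves both for separators and, with \<open>Z = {}\<close>, for proving
  connectedness.\<close>

lemma critical_bipartite_unreachable:
  assumes crit: "critical_bipartite k G U V"
    and Z: "Z \<subseteq> verts G" "card Z < k"
    and x: "x \<in> verts G - Z" and y: "y \<in> verts G - Z"
    and nreach: "\<not> x \<rightarrow>\<^sup>*\<^bsub>delete_verts G Z\<^esub> y"
  shows "\<exists>u\<in>U. neighbors G u \<subseteq> Z"
proof -
  define H where "H = delete_verts G Z"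
  have bip: "bipartite_graph G U V" and cU: "card U = card V + k"
    using crit by (auto simp: critical_bipartite_def)
  interpret graph G using bip by (simp add: bipartite_graph_def)
  interpret H: wf_digraph H unfolding H_def delete_verts_def
    by (rule wellformed_induce_subgraph)
  have disj: "U \<inter> V = {}" and vG: "verts G = U \<union> V"
    using bip by (auto simp: bipartite_graph_def)
  note fin = finite_verts_bipartite[OF bip]
  note dom = dominates_delete_verts_iff[OF wf_digraph_axioms, where Z = Z, folded H_def]
  \<comment> \<open>\<open>A\<close> is the component of \<open>x\<close> in \<open>H\<close>, and
    \<open>B\<close> collects all other components; what matters is that no edge joins
    \<open>A\<close> to \<open>B\<close>.\<close>
  define A where "A = {w. x \<rightarrow>\<^sup>*\<^bsub>H\<^esub> w}"
  define B where "B = verts G - Z - A"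
  have xA: "x \<in> A" using x H.reachable_refl by (simp add: A_def H_def)
  have yB: "y \<in> B" using y nreach by (simp add: A_def B_def H_def)
  have AH: "A \<subseteq> verts G - Z"
    using H.reachable_in_verts(2) by (auto simp: A_def H_def)
  have NA: "neighbors G a \<subseteq> A \<union> Z" if "a \<in> A" for a
  proof
    fix b assume "b \<in> neighbors G a"
    then have "a \<rightarrow>\<^bsub>H\<^esub> b" if "b \<notin> Z"
      using that \<open>a \<in> A\<close> AH dom by (auto simp: neighbors_def)
    then show "b \<in> A \<union> Z" using \<open>a \<in> A\<close> H.reachable_adj_trans unfolding A_def by blast
  qed
  have NB: "neighbors G b \<subseteq> B \<union> Z" if "b \<in> B" for b
  proof
    fix a assume a: "a \<in> neighbors G b"
    then have "b \<in> neighbors G a" "a \<in> verts G"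
      using graph_symmetric adj_in_verts by (auto simp: neighbors_def)
    then show "a \<in> B \<union> Z" using NA[of a] that by (auto simp: B_def)
  qed
  \<comment> \<open>The expansion bound for a generic part \<open>C\<close>, to be used for both
    \<open>A\<close> and \<open>B\<close>: neighbours of \<open>C \<inter> V\<close> lie in
    \<open>U\<close> and do not leave \<open>C \<union> Z\<close>.\<close>
  have big: "card (C \<inter> V) + k \<le> card (C \<inter> U) + card (Z \<inter> U)"
    if "C \<inter> V \<noteq> {}" and C: "\<And>c. c \<in> C \<Longrightarrow> neighbors G c \<subseteq> C \<union> Z" for C
  proof -
    have "card (C \<inter> V) + k \<le> card (\<Union>t\<in>C \<inter> V. neighbors G t)"
      using critical_bipartite_expansion[OF crit] that by blast
    also have "\<dots> \<le> card (C \<inter> U \<union> Z \<inter> U)"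
      using C neighbors_bipartite(2)[OF bip] fin by (intro card_mono) blast+
    also have "\<dots> \<le> card (C \<inter> U) + card (Z \<inter> U)" by (rule card_Un_le)
    finally show ?thesis .
  qed
  have split: "card S = card (A \<inter> S) + card (B \<inter> S) + card (Z \<inter> S)"
    if "S \<subseteq> verts G" for S
  proof -
    have S: "S = A \<inter> S \<union> B \<inter> S \<union> Z \<inter> S" using that AH by (auto simp: B_def)
    have finS: "finite S" using that finite_verts finite_subset by blast
    have "card (A \<inter> S \<union> B \<inter> S \<union> Z \<inter> S) = card (A \<inter> S \<union> B \<inter> S) + card (Z \<inter> S)"
      using finS AH by (intro card_Un_disjoint) (auto simp: B_def)
    also have "card (A \<inter> S \<union> B \<inter> S) = card (A \<inter> S) + card (B \<inter> S)"
      using finS by (intro card_Un_disjoint) (auto simp: B_def)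
    finally show ?thesis using S by simp
  qed
  have "card Z = card (Z \<inter> U) + card (Z \<inter> V)"
  proof -
    have "Z = Z \<inter> U \<union> Z \<inter> V" using Z vG by blast
    moreover have "card (Z \<inter> U \<union> Z \<inter> V) = card (Z \<inter> U) + card (Z \<inter> V)"
      using fin disj by (intro card_Un_disjoint) auto
    ultimately show ?thesis by simp
  qed
  \<comment> \<open>If both parts met \<open>V\<close>, the two instances of \<open>big\<close>
    would count \<open>Z \<inter> U\<close> twice, while \<open>split\<close> for \<open>U\<close>
    removes it once; this yields \<open>k \<le> card Z\<close>.\<close>
  then have "A \<inter> V = {} \<or> B \<inter> V = {}"
    using big[of A] big[of B] NA NB split[of U] split[of V] vG cU Z(2) by fastforce
  \<comment> \<open>A vertex \<open>c\<close> of a part that misses \<open>V\<close> lies in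
    \<open>U\<close>, so its neighbours are in \<open>V\<close>, hence outside the part and inside
    \<open>Z\<close>. Here \<open>c\<close> will be \<open>x\<close> or \<open>y\<close>.\<close>
  moreover have "\<exists>u\<in>U. neighbors G u \<subseteq> Z"
    if "C \<inter> V = {}" "c \<in> C" "c \<in> verts G" "neighbors G c \<subseteq> C \<union> Z" for C c
  proof
    show "c \<in> U" using that vG by blast
    then show "neighbors G c \<subseteq> Z" using that neighbors_bipartite(1)[OF bip] by blast
  qed
  ultimately show ?thesis using xA yB NA NB x y by blast
qed

text \<open>Every edge has an end in \<open>V\<close>, so deleting \<open>V\<close> isolates all
  vertices of \<open>U\<close>. This provides a cut, so that the infimum in
  \<open>set_connectivity\<close> is not the default value \<open>0\<close>.\<close>

lemma vertex_cut_color_class: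
  assumes bip: "bipartite_graph G U V"
    and uv: "u \<in> U" "v \<in> U" "u \<noteq> v" "u \<rightarrow>\<^sup>*\<^bsub>G\<^esub> v"
  shows "vertex_cut G V u v"
proof -
  interpret graph G using bip by (simp add: bipartite_graph_def)
  have "\<not> a \<rightarrow>\<^bsub>delete_verts G V\<^esub> b" for a b
    using bip dominates_delete_verts_iff[OF wf_digraph_axioms]
    unfolding bipartite_graph_def by blast
  then have "\<not> u \<rightarrow>\<^sup>*\<^bsub>delete_verts G V\<^esub> v"
    using uv(3) by (auto simp: reachable_def elim: rtrancl_on.cases)
  then show ?thesis using bip uv by (auto simp: vertex_cut_def bipartite_graph_def)
qed

theorem theorem5p2:
  fixes G :: "('a, 'b) pre_digraph" and U V :: "'a set" and n m k :: nat
  assumes "1 < m" and "m < n" and "k = n - m"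
    and "critical_bipartite k G U V" and "card U = n" and "card V = m"
  shows "set_connectivity G U \<ge> min (min_degree_on G U) k \<and>
    (\<forall>Z. is_separator G Z \<and> card Z < k \<longrightarrow> (\<exists>u\<in>U. neighbors G u \<subseteq> Z))"
proof -
  note crit = assms(4)
  have bip: "bipartite_graph G U V" using crit by (simp add: critical_bipartite_def)
  interpret graph G using bip by (simp add: bipartite_graph_def)
  have vG: "verts G = U \<union> V" using bip by (auto simp: bipartite_graph_def)
  note fin = finite_verts_bipartite[OF bip]
  have sep: "\<exists>u\<in>U. neighbors G u \<subseteq> Z" if cut: "vertex_cut G Z x y" and "card Z < k" for Z x y
  proof (rule critical_bipartite_unreachable[OF crit _ \<open>card Z < k\<close>])
    show "x \<in> verts G - Z" "y \<in> verts G - Z"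
      using cut reachable_in_verts by (auto simp: vertex_cut_def)
  qed (use cut in \<open>auto simp: vertex_cut_def\<close>)
  have mindeg: "min_degree_on G U \<le> card Z" if "u \<in> U" "neighbors G u \<subseteq> Z" "finite Z" for u Z
  proof -
    have "min_degree_on G U \<le> out_degree G u"
      unfolding min_degree_on_def using fin that by (intro Min_le) auto
    also have "\<dots> \<le> card (neighbors G u)" by (rule out_degree_le_card_neighbors) unfold_locales
    also have "\<dots> \<le> card Z" using that by (intro card_mono)
    finally show ?thesis .
  qed
  have "min (min_degree_on G U) k \<le> set_connectivity G U"
  \<comment> \<open>For minimum degree \<open>0\<close> the bound is trivial. Otherwise the set of
    cut sizes must be shown nonempty before each cut is bounded.\<close>
  proof (cases "min_degree_on G U = 0")
    case False
    let ?cuts = "{card Z | Z. \<exists>u\<in>U. \<exists>v\<in>U. vertex_cut G Z u v}"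
    obtain u v where uv: "u \<in> U" "v \<in> U" "u \<noteq> v"
      using assms(1,2,5) by (metis card_le_Suc0_iff_eq fin(1) One_nat_def less_trans not_less)
    \<comment> \<open>The positive minimum degree makes \<open>G\<close> connected: apply the separator argument to \<open>Z = {}\<close>.\<close>
    have "u \<rightarrow>\<^sup>*\<^bsub>delete_verts G {}\<^esub> v"
    proof (rule ccontr)
      assume "\<not> ?thesis"
      then have "\<exists>w\<in>U. neighbors G w \<subseteq> {}"
        using critical_bipartite_unreachable[OF crit, of "{}" u v] uv vG assms(2,3) by simp
      \<comment> \<open>A vertex without neighbours would force the minimum degree down to
        \<open>card {} = 0\<close>.\<close>
      then show False using mindeg[of _ "{}"] False by auto
    qed
    then have "u \<rightarrow>\<^sup>*\<^bsub>G\<^esub> v"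
      by (rule reachable_delete_verts_imp_reachable[OF wf_digraph_axioms])
    then have "?cuts \<noteq> {}" using vertex_cut_color_class[OF bip uv] uv by blast
    moreover have "min (min_degree_on G U) k \<le> card Z" if cut: "vertex_cut G Z x y" for Z x y
    proof (cases "card Z < k")
      case True
      have "finite Z" using cut finite_verts finite_subset unfolding vertex_cut_def by blast
      moreover obtain w where "w \<in> U" "neighbors G w \<subseteq> Z" using sep[OF cut True] by blast
      ultimately have "min_degree_on G U \<le> card Z" by (intro mindeg)
      then show ?thesis by simp
    qed simp
    ultimately show ?thesis
      unfolding set_connectivity_def by (intro cInf_greatest) blast+
  qed simp
  then show ?thesis using sep by (auto simp: is_separator_def)
qed

end
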